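(* Let $G$ be a finite group of order $v$ (not necessarily abelian), and let $k,\lambda$ be positive integers. If for every prime factor $p$ of $v$ there exists a $(p,k,\lambda)$ difference family (respectively, a disjoint $(p,k,\lambda)$ difference family), then there exists a $(v,k,\lambda)$ difference family (respectively, a disjoint $(v,k,\lambda)$ difference family) in $G$.
   Context: Groups are written additively but need not be abelian. For a subset $B$ of a group $G$, $\Delta B$ is the multiset of all differences $b-b'$ of distinct $b,b'\in B$. A $(v,k,\lambda)$ difference family (DF) in a group $G$ of order $v$ is a collection of $k$-subsets of $G$ whose lists of differences together cover every non-zero element of $G$ exactly $\lambda$ times; it is disjoint (DDF) if its members are pairwise disjoint. A $(p,k,\lambda)$-DF means such a family in some group of order $p$ (for $p$ prime, necessarily $\mathbb{Z}_p$).
   Formalization: In the disjoint case it is additionally assumed that v ≤ k whenever λ = k; without this the claim fails (Z_2 is itself a disjoint (2,2,2) family, but Z_4 has no disjoint (4,2,2) family), and a disjoint (v,k,k) family always forces v ≤ k. *)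

theory Defs
  imports "HOL-Algebra.Coset" "HOL-Library.Multiset" "HOL-Computational_Algebra.Primes"
begin

text \<open>
  Groups are the multiplicative ones of HOL-Algebra, so the difference \<open>b - b'\<close> is
  \<open>b \<otimes> inv b'\<close>.
\<close>

definition diff_list :: "('a, 'm) monoid_scheme \<Rightarrow> 'a set \<Rightarrow> 'a multiset" where
  "diff_list G B =
     image_mset (\<lambda>(b, b'). b \<otimes>\<^bsub>G\<^esub> inv\<^bsub>G\<^esub> b') (mset_set {(b, b'). b \<in> B \<and> b' \<in> B \<and> b \<noteq> b'})"

text \<open>A family may contain the same block several times, hence a multiset of blocks.\<close>

definition difference_family ::
  "('a, 'm) monoid_scheme \<Rightarrow> nat \<Rightarrow> nat \<Rightarrow> nat \<Rightarrow> 'a set multiset \<Rightarrow> bool" where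
  "difference_family G v k l F \<longleftrightarrow>
     group G \<and> finite (carrier G) \<and> order G = v \<and>
     (\<forall>B \<in># F. B \<subseteq> carrier G \<and> card B = k) \<and>
     (\<forall>g \<in> carrier G - {\<one>\<^bsub>G\<^esub>}. count (\<Sum>B\<in>#F. diff_list G B) g = l)"

text \<open>The submultiset condition also forbids a nonempty block from occurring twice.\<close>

definition disjoint_difference_family ::
  "('a, 'm) monoid_scheme \<Rightarrow> nat \<Rightarrow> nat \<Rightarrow> nat \<Rightarrow> 'a set multiset \<Rightarrow> bool" where
  "disjoint_difference_family G v k l F \<longleftrightarrow>
     difference_family G v k l F \<and> (\<forall>A B. {#A, B#} \<subseteq># F \<longrightarrow> A \<inter> B = {})"

text \<open>
  Existence in some group of order \<open>v\<close>. Every finite group has an isomorphic copy whose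
  carrier is a set of integers, so fixing the element type loses nothing.
\<close>

definition ex_difference_family :: "nat \<Rightarrow> nat \<Rightarrow> nat \<Rightarrow> bool" where
  "ex_difference_family v k l \<longleftrightarrow> (\<exists>(H :: int monoid) F. difference_family H v k l F)"

definition ex_disjoint_difference_family :: "nat \<Rightarrow> nat \<Rightarrow> nat \<Rightarrow> bool" where
  "ex_disjoint_difference_family v k l \<longleftrightarrow>
     (\<exists>(H :: int monoid) F. disjoint_difference_family H v k l F)"

text \<open>
  The next two facts concern disjoint families with \<open>l = k\<close>. For a prime \<open>p\<close> the cyclic group
  of order \<open>p\<close> itself is the only block of a disjoint \<open>(p, p, p)\<close> family, but a group of order
  \<open>p ^ n\<close> with \<open>n \<ge> 2\<close> has no disjoint \<open>(p ^ n, p, p)\<close> family. Passing from the prime divisors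
  of \<open>v\<close> to a group of order \<open>v\<close> therefore needs \<open>v \<le> k\<close> in case \<open>l = k\<close>.
\<close>

lemma disjoint_difference_family_carrier:
  assumes "group G" "finite (carrier G)" "order G = v"
  shows "disjoint_difference_family G v v v {#carrier G#}"
proof -
  interpret group G by fact
  have "count (diff_list G (carrier G)) g = v" if g: "g \<in> carrier G" "g \<noteq> \<one>\<^bsub>G\<^esub>" for g
  proof -
    let ?P = "{(b, b'). b \<in> carrier G \<and> b' \<in> carrier G \<and> b \<noteq> b'}"
    have fin: "finite ?P"
      by (rule finite_subset[of _ "carrier G \<times> carrier G"]) (use assms in auto)
    have "count (diff_list G (carrier G)) g
        = card {x \<in> ?P. (case x of (b, b') \<Rightarrow> b \<otimes>\<^bsub>G\<^esub> inv\<^bsub>G\<^esub> b') = g}"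
      unfolding diff_list_def using fin
      by (simp add: count_image_mset' sum.If_cases count_mset_set' flip: card_eq_sum)
        (rule arg_cong[where f = card], auto)
    also have "{x \<in> ?P. (case x of (b, b') \<Rightarrow> b \<otimes>\<^bsub>G\<^esub> inv\<^bsub>G\<^esub> b') = g}
        = (\<lambda>b. (g \<otimes>\<^bsub>G\<^esub> b, b)) ` carrier G"
      using g by (auto simp: image_iff m_assoc inv_solve_right' r_cancel_one)
    also have "card \<dots> = v"
      using assms by (simp add: card_image inj_on_def order_def)
    finally show ?thesis .
  qed
  then show ?thesis
    using assms
    by (auto simp: disjoint_difference_family_def difference_family_def order_def
        dest: size_mset_mono)
qed

lemma disjoint_difference_family_order_le:
  assumes ddf: "disjoint_difference_family G v k k F" and "k > 0"
  shows "v \<le> k"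
proof -
  have df: "difference_family G v k k F"
    and disj: "\<And>A B. {#A, B#} \<subseteq># F \<Longrightarrow> A \<inter> B = {}"
    using ddf by (auto simp: disjoint_difference_family_def)
  interpret group G using df by (simp add: difference_family_def)
  have fin: "finite (carrier G)" and v: "card (carrier G) = v"
    using df by (auto simp: difference_family_def order_def)
  have blk: "B \<subseteq> carrier G" "card B = k" "finite B" if "B \<in># F" for B
    using df that fin by (auto simp: difference_family_def intro: finite_subset)
  let ?D = "\<Sum>B\<in>#F. diff_list G B"
  have pairs: "{(b, b'). b \<in> B \<and> b' \<in> B \<and> b \<noteq> b'} = Sigma B (\<lambda>b. B - {b})" for B :: "'a set"
    by auto
  have "size ?D = (\<Sum>B\<in>#F. size (diff_list G B))"
    by (induction F) auto
  also have "\<dots> = (\<Sum>B\<in>#F. k * (k - 1))"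
  proof (rule arg_cong[where f = sum_mset], rule image_mset_cong)
    fix B assume "B \<in># F"
    then show "size (diff_list G B) = k * (k - 1)"
      using blk[of B] unfolding diff_list_def pairs
      by (simp add: card_SigmaI)
  qed
  finally have size1: "size ?D = size F * (k * (k - 1))"
    by simp
  have supp: "set_mset ?D \<subseteq> carrier G - {\<one>\<^bsub>G\<^esub>}"
  proof
    fix x assume "x \<in># ?D"
    then obtain B where B: "B \<in># F" "x \<in># diff_list G B" by auto
    have "finite (Sigma B (\<lambda>b. B - {b}))" using blk[OF B(1)] by auto
    then obtain b b' where "b \<in> B" "b' \<in> B" "b \<noteq> b'" "x = b \<otimes>\<^bsub>G\<^esub> inv\<^bsub>G\<^esub> b'"
      using B(2) unfolding diff_list_def pairs by auto
    moreover from this have "b \<in> carrier G" "b' \<in> carrier G" using blk[OF B(1)] by auto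
    ultimately show "x \<in> carrier G - {\<one>\<^bsub>G\<^esub>}"
      by (auto simp: inv_solve_right')
  qed
  have "size ?D = sum (count ?D) (carrier G - {\<one>\<^bsub>G\<^esub>})"
    unfolding size_multiset_overloaded_eq
    by (rule sum.mono_neutral_left) (use supp fin in \<open>auto simp: count_eq_zero_iff\<close>)
  also have "\<dots> = (\<Sum>g\<in>carrier G - {\<one>\<^bsub>G\<^esub>}. k)"
    by (rule sum.cong) (use df in \<open>auto simp: difference_family_def\<close>)
  also have "\<dots> = (v - 1) * k"
    using fin v by simp
  finally have size2: "size F * (k * (k - 1)) = (v - 1) * k"
    by (rule trans[OF size1[symmetric]])
  have "size F * k \<le> v"
  proof -
    have gen: "card (\<Union>(set_mset E)) = size E * k" if "E \<subseteq># F" for E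
      using that
    proof (induction E)
      case (add A E)
      have A: "A \<in># F" and E: "E \<subseteq># F"
        using add.prems by (auto dest: mset_subset_eqD subset_mset.dual_order.trans
            intro: subset_mset.order_trans[OF _ add.prems])
      have "A \<inter> B = {}" if "B \<in># E" for B
      proof (rule disj)
        have "{#A, B#} \<subseteq># add_mset A E" using that by simp
        then show "{#A, B#} \<subseteq># F" using add.prems by (rule subset_mset.order_trans)
      qed
      then have "A \<inter> \<Union>(set_mset E) = {}" by auto
      moreover have "finite (\<Union>(set_mset E))"
        using blk(3) mset_subset_eqD[OF E] by (intro finite_Union) auto
      ultimately show ?case
        using add.IH[OF E] blk[OF A] by (simp add: card_Un_disjoint)
    qed simp
    have "card (\<Union>(set_mset F)) \<le> card (carrier G)"
      by (rule card_mono) (use blk fin in auto)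
    then show ?thesis using gen[of F] v by simp
  qed
  then have "(v - 1) * k \<le> v * (k - 1)"
    unfolding size2[symmetric] mult.assoc[symmetric] by (rule mult_le_mono1)
  moreover have "v > 0" using fin v by (metis card_gt_0_iff one_closed empty_iff)
  ultimately show ?thesis
    using \<open>k > 0\<close> by (cases v; cases k) (auto simp: algebra_simps)
qed

end

theory Submission
  imports Defs "HOL-Algebra.Multiplicative_Group"
begin

text \<open>
  The blocks are built inside the cyclic subgroups of \<open>G\<close>. Let \<open>C\<close> be a cyclic subgroup of order
  \<open>n > 1\<close> with generator \<open>c\<close>, and let \<open>p\<close> be the least prime factor of \<open>n\<close>. Represent the blocks of a
  family in \<open>\<int>\<^sub>p\<close> by sets \<open>I\<close> of integers in \<open>[0, p)\<close>, and take the blocks \<open>{t\<^sup>i | i \<in> I}\<close> for all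
  generators \<open>t = c\<^sup>u\<close> of \<open>C\<close> with \<open>u \<equiv> 1\<close> modulo \<open>p\<close>. A nonzero difference \<open>e\<close> of elements of \<open>I\<close>
  satisfies \<open>\<bar>e\<bar> < p\<close>, so it is a unit modulo \<open>n\<close>, and the elements \<open>t\<^sup>e\<close> are exactly the generators
  \<open>c\<^sup>w\<close> with \<open>w \<equiv> e\<close> modulo \<open>p\<close>, each obtained once. Hence every generator of \<open>C\<close> is covered
  \<open>\<lambda>\<close> times, and every nonidentity element of \<open>G\<close> generates exactly one \<open>C\<close>.

  If the family in \<open>\<int>\<^sub>p\<close> is disjoint and no block contains \<open>0\<close>, the new blocks consist of
  generators, and the same uniqueness shows that they are disjoint.
\<close>

section \<open>Least prime factors and units modulo n\<close>

definition least_prime_factor :: "nat \<Rightarrow> nat" where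
  "least_prime_factor n = (LEAST q. prime q \<and> q dvd n)"

lemma least_prime_factor:
  assumes "n \<noteq> 1"
  shows "prime (least_prime_factor n)" "least_prime_factor n dvd n"
proof -
  obtain q where "prime q \<and> q dvd n"
    using prime_factor_nat[OF assms] by blast
  then have "prime (least_prime_factor n) \<and> least_prime_factor n dvd n"
    unfolding least_prime_factor_def by (rule LeastI)
  then show "prime (least_prime_factor n)" "least_prime_factor n dvd n"
    by auto
qed

lemma least_prime_factor_le:
  "prime q \<Longrightarrow> q dvd n \<Longrightarrow> least_prime_factor n \<le> q"
  unfolding least_prime_factor_def by (rule Least_le) auto

text \<open>A common prime factor of \<open>e\<close> and \<open>n\<close> would be at most
  \<bar>e\<bar> and at least the least prime factor of \<open>n\<close>.\<close>

lemma coprime_if_less_least_prime_factor: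
  fixes e :: int
  assumes "e \<noteq> 0" "\<bar>e\<bar> < int (least_prime_factor n)"
  shows "coprime e (int n)"
proof -
  have "coprime (nat \<bar>e\<bar>) n"
  proof (rule ccontr)
    assume "\<not> coprime (nat \<bar>e\<bar>) n"
    then obtain q where q: "prime q" "q dvd nat \<bar>e\<bar>" "q dvd n"
      using prime_factor_nat[of "gcd (nat \<bar>e\<bar>) n"]
      by (metis coprime_iff_gcd_eq_1 gcd_greatest_iff)
    then have "q \<le> nat \<bar>e\<bar>"
      using assms(1) by (intro dvd_imp_le) simp_all
    moreover have "least_prime_factor n \<le> q"
      using q by (intro least_prime_factor_le) auto
    ultimately show False
      using assms by linarith
  qed
  then have "coprime (int (nat \<bar>e\<bar>)) (int n)"
    by (simp only: coprime_int_iff)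
  then show ?thesis by simp
qed

lemma coprime_int_inverse:
  fixes e n :: int
  assumes "coprime e n"
  obtains f where "n dvd e * f - 1"
proof -
  obtain u w where "u * e + w * n = 1"
    using bezout_int[of e n] assms by (auto simp: coprime_iff_gcd_eq_1)
  then have "e * u - 1 = n * (- w)"
    by (simp add: algebra_simps)
  then show ?thesis
    using that[of u] by simp
qed

section \<open>Generators of cyclic subgroups\<close>

context group
begin

lemma generate_eqI:
  assumes "x \<in> carrier G" "y \<in> carrier G" "x \<in> generate G {y}" "y \<in> generate G {x}"
  shows "generate G {x} = generate G {y}"
  using assms
  by (intro equalityI generate_subgroup_incl generate_is_subgroup) auto

text \<open>If \<open>f\<close> inverts \<open>e\<close> modulo the order, then x = (x^e)^f, so each
  of the two elements is a power of the other.\<close>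

lemma generate_int_pow_coprime:
  fixes e :: int
  assumes x: "x \<in> carrier G" and e: "coprime e (int (ord x))"
  shows "generate G {x [^] e} = generate G {x}"
proof -
  obtain f where f: "int (ord x) dvd e * f - 1"
    using coprime_int_inverse[OF e] .
  have "x [^] (e * f) = x [^] (1::int)"
    using f x by (subst int_pow_eq) (auto simp: dvd_diff_commute)
  then have "x = (x [^] e) [^] f"
    using x by (simp add: int_pow_pow)
  then show ?thesis
    using x by (intro generate_eqI) (auto simp: generate_pow)
qed

lemma ord_cong_generate:
  "x \<in> carrier G \<Longrightarrow> y \<in> carrier G \<Longrightarrow> generate G {x} = generate G {y} \<Longrightarrow> ord x = ord y"
  by (simp add: generate_pow_card)

text \<open>Since \<open>c\<close> is itself a power of c^w, say with exponent \<open>f\<close>, the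
  relation c^(w f) = c yields a Bezout identity for \<open>w\<close> and the order.\<close>

lemma generate_eq_imp_coprime:
  fixes w :: int
  assumes c: "c \<in> carrier G" and w: "generate G {c [^] w} = generate G {c}"
  shows "coprime w (int (ord c))"
proof -
  have "c \<in> generate G {c [^] w}"
    unfolding w by (simp add: generate.incl)
  then have "c \<in> range (\<lambda>f::int. (c [^] w) [^] f)"
    using c by (simp add: generate_pow full_SetCompr_eq)
  then obtain f :: int where "(c [^] w) [^] f = c"
    by (metis rangeE)
  then have "c [^] (w * f) = c [^] (1::int)"
    using c by (simp add: int_pow_pow)
  then have "int (ord c) dvd 1 - w * f"
    using c by (simp only: int_pow_eq)
  then obtain g where "1 - w * f = int (ord c) * g" ..
  then have "w * f + int (ord c) * g = 1" by simp
  then show ?thesis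
    by (metis coprimeI dvd_add dvd_mult2)
qed

section \<open>Unique representation as small powers of transversal elements\<close>

definition cyclic_rep :: "'a \<Rightarrow> 'a" where
  "cyclic_rep h = (SOME c. c \<in> carrier G \<and> generate G {c} = generate G {h})"

lemma cyclic_rep:
  assumes "h \<in> carrier G"
  shows "cyclic_rep h \<in> carrier G" "generate G {cyclic_rep h} = generate G {h}"
  using someI[of "\<lambda>c. c \<in> carrier G \<and> generate G {c} = generate G {h}" h] assms
  unfolding cyclic_rep_def by auto

text \<open>The choice sees an element only through the subgroup it generates. All generators of one
  cyclic subgroup thus get a common base, and their exponents become comparable.\<close>

lemma cyclic_rep_cong:
  "generate G {x} = generate G {y} \<Longrightarrow> cyclic_rep x = cyclic_rep y"
  by (simp add: cyclic_rep_def)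

abbreviation lpf_ord :: "'a \<Rightarrow> nat" where
  "lpf_ord x \<equiv> least_prime_factor (ord x)"

text \<open>
  Each \<open>h \<noteq> \<one>\<close> is \<open>t [^] d\<close> for exactly one \<open>t\<close> in this set and one \<open>d\<close> with \<open>0 < d < lpf_ord h\<close>.
\<close>

definition power_transversal :: "'a set" where
  "power_transversal =
     {t \<in> carrier G - {\<one>}. \<exists>u::int. t = cyclic_rep t [^] u \<and> int (lpf_ord t) dvd u - 1}"

lemma lpf_ord:
  assumes "h \<in> carrier G" "h \<noteq> \<one>"
  shows "prime (lpf_ord h)" "lpf_ord h dvd ord h"
  using least_prime_factor[of "ord h"] ord_eq_1[OF assms(1)] assms(2) by auto

text \<open>Such an exponent is a unit modulo the order. Hence indices and differences of indices
  never lead out of the set of generators of one subgroup, on which \<open>lpf_ord\<close> and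
  \<open>cyclic_rep\<close> are constant.\<close>

lemma generate_int_pow_less_lpf:
  fixes e :: int
  assumes "t \<in> carrier G" "e \<noteq> 0" "\<bar>e\<bar> < int (lpf_ord t)"
  shows "generate G {t [^] e} = generate G {t}" "ord (t [^] e) = ord t"
proof -
  show *: "generate G {t [^] e} = generate G {t}"
    using assms by (intro generate_int_pow_coprime coprime_if_less_least_prime_factor)
  show "ord (t [^] e) = ord t"
    using * assms by (intro ord_cong_generate) auto
qed

text \<open>The residue \<open>r\<close> is an exponent of \<open>h\<close> over the common base: h
  = c^w. For t = c^u the equation t^e = h means u e \<equiv> w modulo the order n. As
  \<open>e\<close> is a unit modulo n, this determines u modulo n, and then u \<equiv> 1 modulo p
  holds exactly when e \<equiv> w modulo p.\<close>

lemma power_transversal_power: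
  assumes h: "h \<in> carrier G" "h \<noteq> \<one>"
  obtains r :: int where "\<not> int (lpf_ord h) dvd r"
    and "\<And>e::int. e \<noteq> 0 \<Longrightarrow> \<bar>e\<bar> < int (lpf_ord h) \<Longrightarrow> int (lpf_ord h) dvd e - r \<Longrightarrow>
           \<exists>!t. t \<in> power_transversal \<and> lpf_ord t = lpf_ord h \<and> t [^] e = h"
    and "\<And>t (e::int). e \<noteq> 0 \<Longrightarrow> \<bar>e\<bar> < int (lpf_ord h) \<Longrightarrow> t \<in> power_transversal \<Longrightarrow>
           lpf_ord t = lpf_ord h \<Longrightarrow> t [^] e = h \<Longrightarrow> int (lpf_ord h) dvd e - r"
proof -
  define c where "c = cyclic_rep h"
  define p where "p = lpf_ord h"
  define n where "n = int (ord h)"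
  have c: "c \<in> carrier G" "generate G {c} = generate G {h}"
    using cyclic_rep[OF h(1)] by (auto simp: c_def)
  have ord_c: "ord c = ord h"
    using c h by (intro ord_cong_generate) auto
  have p: "prime p" "int p dvd n"
    using lpf_ord[OF h] by (auto simp: p_def n_def)
  have "h \<in> generate G {c}"
    using c h by (simp add: generate.incl)
  then obtain w :: int where w: "h = c [^] w"
    using c by (auto simp: generate_pow)
  have cop_w: "coprime w n"
    using generate_eq_imp_coprime[of c w] c w by (simp add: ord_c n_def)
  have nw: "\<not> int p dvd w"
    using cop_w p by (metis coprime_common_divisor not_prime_unit prime_nat_int_transfer)
  have pow_c: "c [^] a = c [^] b \<longleftrightarrow> n dvd b - a" for a b :: int
    using c by (simp add: int_pow_eq ord_c n_def)
  have gen_t: "generate G {t} = generate G {h}"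
    if t: "t \<in> power_transversal" "lpf_ord t = p" "t [^] e = h" "e \<noteq> 0" "\<bar>e\<bar> < int p" for t and e :: int
    using generate_int_pow_less_lpf(1)[of t e] t by (auto simp: power_transversal_def)
  have exp_t: "\<exists>u::int. t = c [^] u \<and> int p dvd u - 1 \<and> n dvd u * e - w"
    if t: "t \<in> power_transversal" "lpf_ord t = p" "t [^] e = h" "e \<noteq> 0" "\<bar>e\<bar> < int p" for t and e :: int
  proof -
    \<comment> \<open>The elements \<open>t\<close> and \<open>h\<close> generate the same subgroup,
      so the base in the transversal condition for \<open>t\<close> is \<open>c\<close> as
      well.\<close>
    have "cyclic_rep t = c"
      using gen_t[OF t] unfolding c_def by (rule cyclic_rep_cong)
    moreover have "\<exists>u::int. t = cyclic_rep t [^] u \<and> int (lpf_ord t) dvd u - 1"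
      using t(1) unfolding power_transversal_def by blast
    ultimately obtain u :: int where u: "t = c [^] u" "int p dvd u - 1"
      using t(2) by metis
    have "c [^] w = c [^] (u * e)"
      using u t(3) w c by (simp add: int_pow_pow)
    then show ?thesis
      using u pow_c by auto
  qed
  have res: "int p dvd e - w"
    if t: "t \<in> power_transversal" "lpf_ord t = p" "t [^] e = h" "e \<noteq> 0" "\<bar>e\<bar> < int p" for t and e :: int
  proof -
    obtain u where u: "int p dvd u - 1" "n dvd u * e - w"
      using exp_t[OF t] by auto
    \<comment> \<open>Since u \<equiv> 1 modulo p, the congruence for u e becomes one for e: this
      combination equals e - w.\<close>
    have "int p dvd (u * e - w) - (u - 1) * e"
      by (rule dvd_diff[OF dvd_trans[OF p(2) u(2)] dvd_mult2[OF u(1)]])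
    then show ?thesis by (simp add: algebra_simps)
  qed
  have uniq: "t = t'"
    if t: "t \<in> power_transversal" "lpf_ord t = p" "t [^] e = h"
      and t': "t' \<in> power_transversal" "lpf_ord t' = p" "t' [^] e = h"
      and e: "e \<noteq> 0" "\<bar>e\<bar> < int p" for t t' and e :: int
  proof -
    obtain u where u: "t = c [^] u" "n dvd u * e - w"
      using exp_t[OF t e] by auto
    obtain u' where u': "t' = c [^] u'" "n dvd u' * e - w"
      using exp_t[OF t' e] by auto
    have "n dvd (u' * e - w) - (u * e - w)"
      by (rule dvd_diff[OF u'(2) u(2)])
    then have "n dvd (u' - u) * e"
      by (simp add: algebra_simps)
    moreover have "coprime n e"
      using coprime_if_less_least_prime_factor[of e "ord h"] e
      by (simp add: n_def p_def coprime_commute)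
    ultimately have "n dvd u' - u"
      by (simp add: coprime_dvd_mult_left_iff)
    then show ?thesis
      using u u' pow_c by simp
  qed
  have ex: "\<exists>t. t \<in> power_transversal \<and> lpf_ord t = p \<and> t [^] e = h"
    if e: "e \<noteq> 0" "\<bar>e\<bar> < int p" and ew: "int p dvd e - w" for e :: int
  proof -
    have "coprime e n"
      using coprime_if_less_least_prime_factor[of e "ord h"] e
      by (simp add: n_def p_def)
    then obtain f where f: "n dvd e * f - 1"
      using coprime_int_inverse by blast
    \<comment> \<open>The exponent w f solves u e \<equiv> w because \<open>f\<close> inverts
      \<open>e\<close>; it is 1 modulo p because e \<equiv> w there.\<close>
    define t where "t = c [^] (w * f)"
    have te: "t [^] e = h"
    proof -
      have "n dvd w * (e * f - 1)"
        using f by simp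
      then have "n dvd w * f * e - w"
        by (simp add: algebra_simps)
      then have "c [^] w = c [^] (w * f * e)"
        using pow_c by simp
      then show ?thesis
        using c by (simp add: t_def w int_pow_pow)
    qed
    have t: "t \<in> carrier G"
      using c by (simp add: t_def)
    have gen: "generate G {t} = generate G {h}"
    proof (rule generate_eqI)
      show "t \<in> generate G {h}"
        using c by (auto simp: t_def generate_pow simp flip: c(2))
      show "h \<in> generate G {t}"
        using t te by (auto simp: generate_pow)
    qed (use t h in auto)
    have "cyclic_rep t = c"
      using gen unfolding c_def by (rule cyclic_rep_cong)
    moreover have ot: "ord t = ord h"
      using gen t h by (intro ord_cong_generate)
    moreover have "int p dvd w * f - 1"
    proof -
      have "int p dvd (e * f - 1) - (e - w) * f"
        by (rule dvd_diff[OF dvd_trans[OF p(2) f] dvd_mult2[OF ew]])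
      then show ?thesis by (simp add: algebra_simps)
    qed
    moreover have "t \<noteq> \<one>"
      using te h by auto
    ultimately have "t \<in> carrier G - {\<one>}"
      "t = cyclic_rep t [^] (w * f) \<and> int (lpf_ord t) dvd w * f - 1"
      using t unfolding p_def t_def by auto
    then have "t \<in> power_transversal"
      unfolding power_transversal_def by blast
    then show ?thesis
      using te ot by (auto simp: p_def)
  qed
  show ?thesis
  proof (rule that[of w])
    show "\<not> int (lpf_ord h) dvd w"
      using nw by (simp add: p_def)
  qed (use ex uniq res in \<open>unfold p_def, blast+\<close>)
qed

section \<open>Counting differences by pairs of exponents\<close>

lemma count_diff_list:
  assumes "finite B" "B \<subseteq> carrier G" "g \<noteq> \<one>"
  shows "count (diff_list G B) g = card {(b, b') \<in> B \<times> B. b \<otimes> inv b' = g}"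
proof -
  let ?P = "{(b, b'). b \<in> B \<and> b' \<in> B \<and> b \<noteq> b'}"
  have fin: "finite ?P"
    by (rule finite_subset[of _ "B \<times> B"]) (use assms in auto)
  have "count (diff_list G B) g = card {x \<in> ?P. (case x of (b, b') \<Rightarrow> b \<otimes> inv b') = g}"
    unfolding diff_list_def using fin
    by (simp add: count_image_mset' sum.If_cases count_mset_set' flip: card_eq_sum)
      (rule arg_cong[where f = card], auto)
  \<comment> \<open>A diagonal pair has difference \<open>\<one>\<close>, so for \<open>g\<close>
    other than \<open>\<one>\<close> the condition b \<noteq> b' is automatic and the pairs may
    range over a full product.\<close>
  also have "{x \<in> ?P. (case x of (b, b') \<Rightarrow> b \<otimes> inv b') = g}
      = {(b, b') \<in> B \<times> B. b \<otimes> inv b' = g}"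
    using assms by (auto simp: subset_iff)
  finally show ?thesis .
qed

lemma inj_on_int_pow_ord:
  assumes "x \<in> carrier G"
  shows "inj_on (\<lambda>i::int. x [^] i) {0..<int (ord x)}"
proof (rule inj_onI)
  fix i j :: int
  assume ij: "i \<in> {0..<int (ord x)}" "j \<in> {0..<int (ord x)}" "x [^] i = x [^] j"
  then have "int (ord x) dvd j - i"
    using int_pow_eq[OF assms] by blast
  then have "j mod int (ord x) = i mod int (ord x)"
    by (simp add: mod_eq_dvd_iff)
  then show "i = j"
    using ij by simp
qed

text \<open>Below the order of \<open>t\<close> the map from i to t^i is injective, so counting in a
  block reduces to counting among its exponents.\<close>

lemma card_pairs_int_pow:
  assumes t: "t \<in> carrier G" and I: "I \<subseteq> {0..<int (ord t)}"
  shows "card {(b, b') \<in> ((\<lambda>i. t [^] i) ` I) \<times> ((\<lambda>i. t [^] i) ` I). b \<otimes> inv b' = h}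
       = card {(i, j) \<in> I \<times> I. t [^] (i - j) = h}"
proof -
  have inj: "inj_on (\<lambda>i::int. t [^] i) I"
    using inj_on_subset[OF inj_on_int_pow_ord[OF t] I] .
  have "{(b, b') \<in> ((\<lambda>i. t [^] i) ` I) \<times> ((\<lambda>i. t [^] i) ` I). b \<otimes> inv b' = h}
      = map_prod (\<lambda>i. t [^] i) (\<lambda>i. t [^] i) ` {(i, j) \<in> I \<times> I. t [^] (i - j) = h}"
    using t by (auto simp: int_pow_diff)
  also have "card \<dots> = card {(i, j) \<in> I \<times> I. t [^] (i - j) = h}"
    using inj by (intro card_image inj_on_subset[OF map_prod_inj_on[OF inj inj]]) auto
  finally show ?thesis .
qed

end

section \<open>Sums over multisets and double counting\<close>

lemma sum_mset_sum_image:
  "finite T \<Longrightarrow> (\<Sum>x\<in>#(\<Sum>t\<in>T. M t). f x) = (\<Sum>t\<in>T. \<Sum>x\<in>#M t. f x :: 'b :: comm_monoid_add)"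
  by (induction T rule: finite_induct) auto

lemma sum_sum_mset_swap:
  "(\<Sum>t\<in>T. \<Sum>x\<in>#M. f t x) = (\<Sum>x\<in>#M. \<Sum>t\<in>T. f t x :: 'b :: comm_monoid_add)"
  by (induction M) (auto simp: sum.distrib)

lemma count_sum_mset_image:
  "count (\<Sum>x\<in>#M. f x) a = (\<Sum>x\<in>#M. count (f x) a)"
  by (induction M) auto

lemma size_filter_eq_sum_mset:
  "size (filter_mset P M) = (\<Sum>x\<in>#M. of_bool (P x))"
  by (induction M) auto

lemma sum_card_swap:
  assumes "finite A" "finite B"
  shows "(\<Sum>a\<in>A. card {b \<in> B. R a b}) = (\<Sum>b\<in>B. card {a \<in> A. R a b})"
  using sum.swap[of "\<lambda>a b. of_bool (R a b) :: nat" B A] assms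
  by (simp add: sum_of_bool_eq Int_def)

text \<open>Two members of \<open>F\<close> sharing \<open>x\<close>, counted with multiplicity, are
  the same as a filtered multiset of size at least two. The pointwise bound is a sum over the blocks
  and so can be estimated for a sum of families.\<close>

lemma pairwise_disjoint_mset_iff:
  "(\<forall>A B. {#A, B#} \<subseteq># F \<longrightarrow> A \<inter> B = {}) \<longleftrightarrow> (\<forall>x. size {#B \<in># F. x \<in> B#} \<le> 1)"
proof (intro iffI allI impI)
  fix x
  assume disj: "\<forall>A B. {#A, B#} \<subseteq># F \<longrightarrow> A \<inter> B = {}"
  show "size {#B \<in># F. x \<in> B#} \<le> 1"
  proof (rule ccontr)
    assume "\<not> size {#B \<in># F. x \<in> B#} \<le> 1"
    \<comment> \<open>Two members are split off; they may be equal as sets, which the pair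
      \<open>{#A, B#}\<close> allows.\<close>
    then have "size {#B \<in># F. x \<in> B#} = Suc (Suc (size {#B \<in># F. x \<in> B#} - 2))"
      by simp
    then obtain A M where A: "{#B \<in># F. x \<in> B#} = add_mset A M"
      using size_eq_Suc_imp_eq_union by blast
    then have "M \<noteq> {#}"
      using \<open>\<not> size {#B \<in># F. x \<in> B#} \<le> 1\<close> by auto
    then obtain B N where "M = add_mset B N"
      using multi_nonempty_split by blast
    with A have N: "{#B \<in># F. x \<in> B#} = add_mset A (add_mset B N)"
      by simp
    have "{#A, B#} \<subseteq># {#B \<in># F. x \<in> B#}"
      unfolding N by simp
    then have "{#A, B#} \<subseteq># F"
      using multiset_filter_subset subset_mset.order_trans by blast
    moreover have "A \<in># {#B \<in># F. x \<in> B#}" "B \<in># {#B \<in># F. x \<in> B#}"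
      unfolding N by auto
    ultimately show False
      using disj by fastforce
  qed
next
  fix A B
  assume le: "\<forall>x. size {#B \<in># F. x \<in> B#} \<le> 1" and AB: "{#A, B#} \<subseteq># F"
  show "A \<inter> B = {}"
  proof (rule ccontr)
    assume "A \<inter> B \<noteq> {}"
    then obtain x where x: "x \<in> A" "x \<in> B" by auto
    have "filter_mset (\<lambda>B. x \<in> B) {#A, B#} \<subseteq># {#B \<in># F. x \<in> B#}"
      using AB by (rule multiset_filter_mono)
    then have "size {#A, B#} \<le> size {#B \<in># F. x \<in> B#}"
      using x by (auto dest: size_mset_mono)
    then show False
      using le[rule_format, of x] by simp
  qed
qed

text \<open>A difference family of the cyclic group of order \<open>p\<close>, with residues as representatives.\<close>

definition index_family :: "nat \<Rightarrow> nat \<Rightarrow> nat \<Rightarrow> int set multiset \<Rightarrow> bool" where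
  "index_family p k l F \<longleftrightarrow>
     (\<forall>I\<in>#F. I \<subseteq> {0..<int p} \<and> card I = k) \<and>
     (\<forall>r. \<not> int p dvd r \<longrightarrow> (\<Sum>I\<in>#F. card {(i, j) \<in> I \<times> I. int p dvd i - j - r}) = l)"

text \<open>Index 0 is excluded because t^0 is the identity for every \<open>t\<close>: blocks over
  different \<open>t\<close> would meet there.\<close>

definition disjoint_index_family :: "nat \<Rightarrow> nat \<Rightarrow> nat \<Rightarrow> int set multiset \<Rightarrow> bool" where
  "disjoint_index_family p k l F \<longleftrightarrow>
     index_family p k l F \<and> (\<forall>I\<in>#F. 0 \<notin> I) \<and> (\<forall>i. size {#I \<in># F. i \<in> I#} \<le> 1)"

section \<open>Lifting families from the primes to the group\<close>

context group
begin

definition lifted_family :: "(nat \<Rightarrow> int set multiset) \<Rightarrow> 'a set multiset" where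
  "lifted_family Fi =
     (\<Sum>t\<in>power_transversal. image_mset (\<lambda>I. (\<lambda>i. t [^] i) ` I) (Fi (lpf_ord t)))"

lemma power_transversal_subset: "power_transversal \<subseteq> carrier G - {\<one>}"
  by (auto simp: power_transversal_def)

text \<open>For fixed \<open>h\<close>, count the solutions of t^(i-j) = h. After the sums are
  exchanged, a pair (i, j) has one solution \<open>t\<close> if i - j \<equiv> r modulo p and none
  otherwise, so the total is the number of differences of residue \<open>r\<close> in the index
  family for p.\<close>

lemma difference_family_lifted:
  assumes fin: "finite (carrier G)"
    and Fi: "\<And>p. prime p \<Longrightarrow> p dvd order G \<Longrightarrow> index_family p k l (Fi p)"
  shows "difference_family G (order G) k l (lifted_family Fi)"
proof -
  let ?T = power_transversal
  have finT: "finite ?T"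
    using power_transversal_subset fin by (meson finite_Diff finite_subset)
  have T: "t \<in> carrier G" "lpf_ord t \<le> ord t"
    "index_family (lpf_ord t) k l (Fi (lpf_ord t))"
    if "t \<in> ?T" for t
  proof -
    show t: "t \<in> carrier G"
      using that power_transversal_subset by auto
    have "t \<noteq> \<one>"
      using that power_transversal_subset by auto
    note p = lpf_ord[OF t this]
    show "lpf_ord t \<le> ord t"
      using p ord_ge_1[OF fin t] by (intro dvd_imp_le) auto
    show "index_family (lpf_ord t) k l (Fi (lpf_ord t))"
      using p ord_dvd_group_order[OF t] by (intro Fi) (auto intro: dvd_trans)
  qed
  have I: "I \<subseteq> {0..<int (lpf_ord t)}" "I \<subseteq> {0..<int (ord t)}" "card I = k" "finite I"
    if "t \<in> ?T" "I \<in># Fi (lpf_ord t)" for t I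
  proof -
    show *: "I \<subseteq> {0..<int (lpf_ord t)}" "card I = k"
      using T(3)[OF that(1)] that(2) by (auto simp: index_family_def)
    show "finite I"
      using *(1) by (rule finite_subset) simp
    show "I \<subseteq> {0..<int (ord t)}"
      using *(1) T(2)[OF that(1)] by force
  qed
  have "B \<subseteq> carrier G \<and> card B = k" if "B \<in># lifted_family Fi" for B
  proof -
    obtain t J where tJ: "t \<in> ?T" "J \<in># Fi (lpf_ord t)" "B = (\<lambda>i. t [^] i) ` J"
      using \<open>B \<in># lifted_family Fi\<close> finT by (auto simp: lifted_family_def set_mset_sum)
    have "card B = card J"
      unfolding tJ(3) using inj_on_subset[OF inj_on_int_pow_ord[OF T(1)[OF tJ(1)]] I(2)[OF tJ(1,2)]]
      by (rule card_image)
    then show ?thesis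
      using I(3)[OF tJ(1,2)] T(1)[OF tJ(1)] tJ(3) by auto
  qed
  moreover have "count (\<Sum>B\<in>#lifted_family Fi. diff_list G B) h = l"
    if h: "h \<in> carrier G" "h \<noteq> \<one>" for h
  proof -
    define p where "p = lpf_ord h"
    obtain r :: int where r: "\<not> int p dvd r"
      and r1: "\<And>e::int. e \<noteq> 0 \<Longrightarrow> \<bar>e\<bar> < int p \<Longrightarrow> int p dvd e - r \<Longrightarrow>
           \<exists>!t. t \<in> power_transversal \<and> lpf_ord t = p \<and> t [^] e = h"
      and r2: "\<And>t (e::int). e \<noteq> 0 \<Longrightarrow> \<bar>e\<bar> < int p \<Longrightarrow> t \<in> power_transversal \<Longrightarrow>
           lpf_ord t = p \<Longrightarrow> t [^] e = h \<Longrightarrow> int p dvd e - r"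
      by (rule power_transversal_power[OF h, folded p_def]) blast
    define Tp where "Tp = {t \<in> ?T. lpf_ord t = p}"
    have finTp: "finite Tp"
      using finT by (simp add: Tp_def)
    \<comment> \<open>For i = j both sides vanish, since t^0 \<noteq> h and p does not divide
      \<open>r\<close>. For i \<noteq> j the difference is small enough for the two facts about
      \<open>r\<close>.\<close>
    have card_t: "card {t \<in> Tp. t [^] (i - j) = h} = of_bool (int p dvd i - j - r)"
      if ij: "i \<in> {0..<int p}" "j \<in> {0..<int p}" for i j
    proof (cases "i = j")
      case True
      then show ?thesis
        using h r by simp
    next
      case False
      then have e: "i - j \<noteq> 0" "\<bar>i - j\<bar> < int p"
        using ij by auto
      show ?thesis
      proof (cases "int p dvd i - j - r")
        case True
        have "is_singleton {t \<in> Tp. t [^] (i - j) = h}"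
          using r1[OF e True] unfolding Tp_def is_singleton_def by auto
        then show ?thesis
          using True by (simp add: is_singleton_altdef)
      next
        case False
        then have "{t \<in> Tp. t [^] (i - j) = h} = {}"
          using r2[OF e] unfolding Tp_def by blast
        then show ?thesis
          using False by (simp only: card.empty of_bool_eq)
      qed
    qed
    have "count (\<Sum>B\<in>#lifted_family Fi. diff_list G B) h
        = (\<Sum>t\<in>?T. \<Sum>I\<in>#Fi (lpf_ord t). count (diff_list G ((\<lambda>i. t [^] i) ` I)) h)"
      using finT unfolding lifted_family_def count_sum_mset_image
      by (simp add: sum_mset_sum_image image_mset.compositionality comp_def)
    also have "\<dots> = (\<Sum>t\<in>?T. \<Sum>I\<in>#Fi (lpf_ord t). card {(i, j) \<in> I \<times> I. t [^] (i - j) = h})"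
    proof (intro sum.cong refl arg_cong[where f = sum_mset] image_mset_cong)
      fix t J
      assume t: "t \<in> ?T" and J: "J \<in># Fi (lpf_ord t)"
      show "count (diff_list G ((\<lambda>i. t [^] i) ` J)) h = card {(i, j) \<in> J \<times> J. t [^] (i - j) = h}"
        unfolding card_pairs_int_pow[OF T(1)[OF t] I(2)[OF t J], symmetric]
        using I(4)[OF t J] T(1)[OF t] h by (intro count_diff_list) auto
    qed
    \<comment> \<open>Other \<open>t\<close> contribute nothing: for i \<noteq> j the power t^(i-j)
      has the order of \<open>t\<close>, hence a least prime factor different from that of
      \<open>h\<close>.\<close>
    also have "\<dots> = (\<Sum>t\<in>Tp. \<Sum>I\<in>#Fi (lpf_ord t). card {(i, j) \<in> I \<times> I. t [^] (i - j) = h})"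
    proof (rule sum.mono_neutral_right[OF finT], goal_cases)
      case 2
      show ?case
      proof (intro ballI)
        fix t
        assume t: "t \<in> ?T - Tp"
        have "card {(i, j) \<in> J \<times> J. t [^] (i - j) = h} = 0" if J: "J \<in># Fi (lpf_ord t)" for J
        proof -
          have "t [^] (i - j) \<noteq> h" if ij: "i \<in> J" "j \<in> J" for i j
          proof (cases "i = j")
            case False
            have "i \<in> {0..<int (lpf_ord t)}" "j \<in> {0..<int (lpf_ord t)}"
              using I(1)[of t J] t J ij by auto
            then have "ord (t [^] (i - j)) = ord t"
              using False T(1) t by (intro generate_int_pow_less_lpf(2)) auto
            then show ?thesis
              using t unfolding Tp_def p_def by auto
          qed (use h in auto)
          then have "{(i, j) \<in> J \<times> J. t [^] (i - j) = h} = {}"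
            by auto
          then show ?thesis
            by (simp only: card.empty)
        qed
        then show "(\<Sum>I\<in>#Fi (lpf_ord t). card {(i, j) \<in> I \<times> I. t [^] (i - j) = h}) = 0"
          by (simp only: sum_mset_0_iff) (simp only: set_image_mset image_iff ball_simps, blast)
      qed
    qed (auto simp: Tp_def)
    also have "\<dots> = (\<Sum>t\<in>Tp. \<Sum>I\<in>#Fi p. card {(i, j) \<in> I \<times> I. t [^] (i - j) = h})"
      by (intro sum.cong) (auto simp: Tp_def)
    also have "\<dots> = (\<Sum>I\<in>#Fi p. \<Sum>t\<in>Tp. card {(i, j) \<in> I \<times> I. t [^] (i - j) = h})"
      by (rule sum_sum_mset_swap)
    also have "\<dots> = (\<Sum>I\<in>#Fi p. card {(i, j) \<in> I \<times> I. int p dvd i - j - r})"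
    proof (intro arg_cong[where f = sum_mset] image_mset_cong)
      fix J
      assume J: "J \<in># Fi p"
      have idx: "index_family p k l (Fi p)"
        using lpf_ord[OF h] ord_dvd_group_order[OF h(1)] unfolding p_def
        by (intro Fi) (auto intro: dvd_trans)
      have Jp: "J \<subseteq> {0..<int p}"
        using J idx by (auto simp: index_family_def)
      then have finJ: "finite (J \<times> J)"
        by (meson finite_SigmaI finite_atLeastLessThan_int finite_subset)
      \<comment> \<open>Double counting of the incidences between elements \<open>t\<close> and
        index pairs.\<close>
      have "(\<Sum>t\<in>Tp. card {(i, j) \<in> J \<times> J. t [^] (i - j) = h})
          = (\<Sum>t\<in>Tp. card {x \<in> J \<times> J. t [^] (fst x - snd x) = h})"
        by (intro sum.cong arg_cong[where f = card]) auto
      also have "\<dots> = (\<Sum>x\<in>J \<times> J. card {t \<in> Tp. t [^] (fst x - snd x) = h})"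
        by (rule sum_card_swap[OF finTp finJ])
      also have "\<dots> = (\<Sum>x\<in>J \<times> J. of_bool (int p dvd fst x - snd x - r))"
        using Jp by (intro sum.cong card_t) auto
      also have "\<dots> = card {x \<in> J \<times> J. int p dvd fst x - snd x - r}"
        using finJ by (simp add: sum_of_bool_eq Int_def)
      also have "\<dots> = card {(i, j) \<in> J \<times> J. int p dvd i - j - r}"
        by (intro arg_cong[where f = card]) auto
      finally show "(\<Sum>t\<in>Tp. card {(i, j) \<in> J \<times> J. t [^] (i - j) = h})
        = card {(i, j) \<in> J \<times> J. int p dvd i - j - r}" .
    qed
    also have "\<dots> = l"
      using Fi[of p] lpf_ord[OF h] ord_dvd_group_order[OF h(1)] r
      unfolding p_def index_family_def by (meson dvd_trans)
    finally show ?thesis .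
  qed
  ultimately show ?thesis
    using fin by (auto simp: difference_family_def is_group)
qed

text \<open>If h = t^i lies in a lifted block, its residue \<open>r\<close> determines the index i,
  and i determines \<open>t\<close>. So \<open>h\<close> is covered at most as often as that index
  is covered in the index family for p.\<close>

lemma disjoint_difference_family_lifted:
  assumes fin: "finite (carrier G)"
    and Fi: "\<And>p. prime p \<Longrightarrow> p dvd order G \<Longrightarrow> disjoint_index_family p k l (Fi p)"
  shows "disjoint_difference_family G (order G) k l (lifted_family Fi)"
proof -
  let ?T = power_transversal
  have finT: "finite ?T"
    using power_transversal_subset fin by (meson finite_Diff finite_subset)
  have I: "0 < i \<and> i < int (lpf_ord t)"
    if t: "t \<in> ?T" and J: "J \<in># Fi (lpf_ord t)" and i: "i \<in> J" for t i J
  proof -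
    have "t \<in> carrier G" "t \<noteq> \<one>"
      using t power_transversal_subset by auto
    then have "disjoint_index_family (lpf_ord t) k l (Fi (lpf_ord t))"
      using lpf_ord ord_dvd_group_order by (intro Fi) (auto intro: dvd_trans)
    then have "J \<subseteq> {0..<int (lpf_ord t)}" "0 \<notin> J"
      using J by (auto simp: disjoint_index_family_def index_family_def)
    then have "i \<in> {0..<int (lpf_ord t)}" "i \<noteq> 0"
      using i by auto
    then show ?thesis by auto
  qed
  have gen: "ord (t [^] i) = ord t \<and> t [^] i \<noteq> \<one>"
    if t: "t \<in> ?T" and J: "J \<in># Fi (lpf_ord t)" and i: "i \<in> J" for t i J
  proof -
    have tG: "t \<in> carrier G" "t \<noteq> \<one>"
      using t power_transversal_subset by auto
    have "ord (t [^] i) = ord t"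
      using I[OF t J i] tG by (intro generate_int_pow_less_lpf(2)) auto
    then show ?thesis
      using tG by (metis ord_eq_1 ord_id)
  qed
  have "size {#B \<in># lifted_family Fi. h \<in> B#} \<le> 1" for h
  proof (cases "h \<in> carrier G \<and> h \<noteq> \<one>")
    case False
    \<comment> \<open>All indices are positive and below the least prime factor, so lifted blocks
      contain only nonidentity elements of the group.\<close>
    have "h \<notin> B" if B: "B \<in># lifted_family Fi" for B
    proof
      assume "h \<in> B"
      then obtain t J i where *: "t \<in> ?T" "J \<in># Fi (lpf_ord t)" "i \<in> J" "h = t [^] i"
        using B finT by (auto simp: lifted_family_def set_mset_sum)
      then show False
        using gen[OF *(1,2,3)] power_transversal_subset False by auto
    qed
    then have "{#B \<in># lifted_family Fi. h \<in> B#} = {#}"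
      by (auto simp: multiset_eq_iff count_eq_zero_iff)
    then show ?thesis by (metis size_empty zero_le)
  next
    case True
    then have h: "h \<in> carrier G" "h \<noteq> \<one>" by auto
    define p where "p = lpf_ord h"
    have p: "prime p"
      using lpf_ord[OF h] by (simp add: p_def)
    have disj: "disjoint_index_family p k l (Fi p)"
      using lpf_ord[OF h] ord_dvd_group_order[OF h(1)] unfolding p_def
      by (intro Fi) (auto intro: dvd_trans)
    obtain r :: int where r: "\<not> int p dvd r"
      and r1: "\<And>e::int. e \<noteq> 0 \<Longrightarrow> \<bar>e\<bar> < int p \<Longrightarrow> int p dvd e - r \<Longrightarrow>
           \<exists>!t. t \<in> power_transversal \<and> lpf_ord t = p \<and> t [^] e = h"
      and r2: "\<And>t (e::int). e \<noteq> 0 \<Longrightarrow> \<bar>e\<bar> < int p \<Longrightarrow> t \<in> power_transversal \<Longrightarrow>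
           lpf_ord t = p \<Longrightarrow> t [^] e = h \<Longrightarrow> int p dvd e - r"
      by (rule power_transversal_power[OF h, folded p_def]) blast
    \<comment> \<open>The only candidate index for \<open>h\<close>: the representative of
      \<open>r\<close> between 0 and p, nonzero because p does not divide \<open>r\<close>.\<close>
    define d where "d = r mod int p"
    have "int p > 0"
      using prime_gt_0_nat[OF p] by simp
    then have "0 \<le> d" "d < int p"
      by (auto simp: d_def)
    moreover have "int p dvd d - r"
      by (simp add: d_def flip: mod_eq_dvd_iff)
    moreover have "d \<noteq> 0"
      using r by (simp add: d_def dvd_eq_mod_eq_0)
    ultimately have d: "0 < d" "d < int p" "int p dvd d - r"
      by auto
    obtain t\<^sub>0 where t0: "t\<^sub>0 \<in> ?T" "lpf_ord t\<^sub>0 = p"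
      and t0_uniq: "\<And>t. t \<in> ?T \<Longrightarrow> lpf_ord t = p \<Longrightarrow> t [^] d = h \<Longrightarrow> t = t\<^sub>0"
      using r1[of d] d by auto
    have key: "t = t\<^sub>0 \<and> d \<in> J"
      if t: "t \<in> ?T" and J: "J \<in># Fi (lpf_ord t)" and hJ: "h \<in> (\<lambda>i. t [^] i) ` J" for t J
    proof -
      obtain i where i: "i \<in> J" "h = t [^] i"
        using hJ by auto
      have tp: "lpf_ord t = p"
        using gen[OF t J i(1)] i(2) by (simp add: p_def)
      have ip: "0 < i" "i < int p"
        using I[OF t J i(1)] tp by auto
      have "int p dvd i - r"
        using r2[of i t] ip t tp i(2) by auto
      then have "i = d"
        using ip d(1,2) by (simp add: d_def flip: mod_eq_dvd_iff)
      then show ?thesis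
        using t0_uniq t tp i by auto
    qed
    have "size {#B \<in># lifted_family Fi. h \<in> B#}
        = (\<Sum>t\<in>?T. \<Sum>I\<in>#Fi (lpf_ord t). of_bool (h \<in> (\<lambda>i. t [^] i) ` I))"
      using finT unfolding lifted_family_def size_filter_eq_sum_mset
      by (simp add: sum_mset_sum_image image_mset.compositionality comp_def)
    \<comment> \<open>By \<open>key\<close>, only blocks over the one element
      \<open>t\<^sub>0\<close> can contain \<open>h\<close>, and only if their index set contains
      \<open>d\<close>.\<close>
    also have "\<dots> \<le> (\<Sum>t\<in>?T. if t = t\<^sub>0 then \<Sum>I\<in>#Fi p. of_bool (d \<in> I) else 0)"
    proof (rule sum_mono)
      fix t
      assume t: "t \<in> ?T"
      have "(\<Sum>I\<in>#Fi (lpf_ord t). of_bool (h \<in> (\<lambda>i. t [^] i) ` I) :: nat)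
          \<le> (\<Sum>I\<in>#Fi (lpf_ord t). of_bool (t = t\<^sub>0 \<and> d \<in> I))"
        using key[OF t] by (intro sum_mset_mono) auto
      also have "\<dots> = (if t = t\<^sub>0 then \<Sum>I\<in>#Fi p. of_bool (d \<in> I) else 0)"
        using t0 by simp
      finally show "(\<Sum>I\<in>#Fi (lpf_ord t). of_bool (h \<in> (\<lambda>i. t [^] i) ` I) :: nat) \<le> \<dots>" .
    qed
    also have "\<dots> = size {#I \<in># Fi p. d \<in> I#}"
      using finT t0 by (simp add: size_filter_eq_sum_mset)
    also have "\<dots> \<le> 1"
      using disj by (simp add: disjoint_index_family_def)
    finally show ?thesis .
  qed
  then show ?thesis
    using difference_family_lifted[OF fin, of k l Fi] Fi
    by (simp add: disjoint_difference_family_def pairwise_disjoint_mset_iff disjoint_index_family_def)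
qed

section \<open>Families in groups of prime order as index families\<close>

lemma index_family_of_difference_family:
  assumes df: "difference_family G p k l F" and p: "prime p" and y: "y \<in> carrier G"
  obtains \<phi> :: "int \<Rightarrow> 'a" where "\<phi> 0 = y"
    "index_family p k l (image_mset (\<lambda>B. {i \<in> {0..<int p}. \<phi> i \<in> B}) F)"
proof -
  have fin: "finite (carrier G)" and ord: "order G = p"
    and blk: "\<And>B. B \<in># F \<Longrightarrow> B \<subseteq> carrier G \<and> card B = k"
    and cnt: "\<And>g. g \<in> carrier G \<Longrightarrow> g \<noteq> \<one> \<Longrightarrow> count (\<Sum>B\<in>#F. diff_list G B) g = l"
    using df by (auto simp: difference_family_def)
  have "card (carrier G) > 1"
    using ord prime_gt_1_nat[OF p] by (simp add: order_def)
  then obtain x where x: "x \<in> carrier G" "x \<noteq> \<one>"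
    by (metis card_le_Suc0_iff_eq fin not_le One_nat_def one_closed)
  have ord_x: "ord x = p"
    using ord_dvd_group_order[OF x(1)] ord_eq_1[OF x(1)] x(2) p ord by (auto simp: prime_nat_iff)
  \<comment> \<open>Powers of \<open>x\<close> enumerate the group; the right factor
    \<open>y\<close> cancels in all differences and puts \<open>y\<close> at index 0.\<close>
  define \<phi> where "\<phi> = (\<lambda>i::int. x [^] i \<otimes> y)"
  have inj: "inj_on \<phi> {0..<int p}"
    using inj_on_int_pow_ord[OF x(1)] x y by (auto simp: inj_on_def \<phi>_def ord_x)
  have "\<phi> ` {0..<int p} \<subseteq> carrier G"
    using x y by (auto simp: \<phi>_def)
  moreover have "card (\<phi> ` {0..<int p}) = card (carrier G)"
    using card_image[OF inj] ord by (simp add: order_def)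
  ultimately have surj: "\<phi> ` {0..<int p} = carrier G"
    using fin by (intro card_subset_eq) auto
  have diff: "\<phi> i \<otimes> inv \<phi> j = x [^] (i - j)" for i j
    using x y by (simp add: \<phi>_def int_pow_diff inv_mult_group m_assoc[symmetric])
      (simp add: m_assoc)
  define ix where "ix B = {i \<in> {0..<int p}. \<phi> i \<in> B}" for B
  have img: "\<phi> ` ix B = B" if "B \<subseteq> carrier G" for B
  proof (intro equalityI subsetI)
    fix b
    assume b: "b \<in> B"
    then have "b \<in> \<phi> ` {0..<int p}"
      using that surj by auto
    then show "b \<in> \<phi> ` ix B"
      using b unfolding ix_def by blast
  qed (auto simp: ix_def)
  have inj_ix: "inj_on \<phi> (ix B)" for B
    using inj by (rule inj_on_subset) (auto simp: ix_def)
  have "card (ix B) = k" if "B \<in># F" for B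
    using card_image[OF inj_ix[of B]] img[of B] blk[OF that] by simp
  moreover have "(\<Sum>I\<in>#image_mset ix F. card {(i, j) \<in> I \<times> I. int p dvd i - j - r}) = l"
    if r: "\<not> int p dvd r" for r
  proof -
    have g: "x [^] r \<in> carrier G" "x [^] r \<noteq> \<one>"
      using x r by (auto simp: int_pow_eq_id ord_x)
    have "l = (\<Sum>B\<in>#F. count (diff_list G B) (x [^] r))"
      using cnt[OF g] by (simp add: count_sum_mset_image)
    also have "\<dots> = (\<Sum>B\<in>#F. card {(i, j) \<in> ix B \<times> ix B. int p dvd i - j - r})"
    proof (intro arg_cong[where f = sum_mset] image_mset_cong)
      fix B
      assume "B \<in># F"
      then have B: "B \<subseteq> carrier G" "finite B"
        using blk fin by (auto intro: finite_subset)
      have eq: "\<phi> i \<otimes> inv \<phi> j = x [^] r \<longleftrightarrow> int p dvd i - j - r" for i j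
        unfolding diff using x by (simp add: int_pow_eq ord_x dvd_diff_commute)
      have "count (diff_list G B) (x [^] r) = card {(b, b') \<in> B \<times> B. b \<otimes> inv b' = x [^] r}"
        using B g by (intro count_diff_list) auto
      also have "{(b, b') \<in> B \<times> B. b \<otimes> inv b' = x [^] r}
          = map_prod \<phi> \<phi> ` {(i, j) \<in> ix B \<times> ix B. int p dvd i - j - r}"
        unfolding eq[symmetric] by (subst (1 2) img[OF B(1), symmetric]) auto
      also have "card \<dots> = card {(i, j) \<in> ix B \<times> ix B. int p dvd i - j - r}"
        by (intro card_image inj_on_subset[OF map_prod_inj_on[OF inj_ix inj_ix]]) auto
      finally show "count (diff_list G B) (x [^] r)
          = card {(i, j) \<in> ix B \<times> ix B. int p dvd i - j - r}" .
    qed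
    finally show ?thesis
      by (simp add: image_mset.compositionality comp_def)
  qed
  ultimately have "index_family p k l (image_mset ix F)"
    by (auto simp: index_family_def ix_def)
  then show ?thesis
    using y by (intro that[of \<phi>]) (auto simp: \<phi>_def ix_def[abs_def])
qed

text \<open>
  A disjoint family covering the whole group of prime order \<open>p\<close> has \<open>k\<close> dividing \<open>p\<close>, hence consists
  of the group itself. Otherwise a translation moves an uncovered element to the identity.
\<close>

lemma disjoint_difference_family_uncovered:
  assumes ddf: "disjoint_difference_family G p k l F" and p: "prime p" and "l > 0" "l \<noteq> k"
  obtains y where "y \<in> carrier G" "\<And>B. B \<in># F \<Longrightarrow> y \<notin> B"
proof (rule ccontr)
  assume "\<not> thesis"
  with that have cov: "\<exists>B. B \<in># F \<and> y \<in> B" if "y \<in> carrier G" for y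
    using \<open>y \<in> carrier G\<close> by blast
  have fin: "finite (carrier G)" and ord: "card (carrier G) = p"
    and blk: "\<And>B. B \<in># F \<Longrightarrow> B \<subseteq> carrier G \<and> card B = k"
    and cnt: "\<And>g. g \<in> carrier G \<Longrightarrow> g \<noteq> \<one> \<Longrightarrow> count (\<Sum>B\<in>#F. diff_list G B) g = l"
    and le: "\<And>x. size {#B \<in># F. x \<in> B#} \<le> 1"
    using ddf
    by (auto simp: disjoint_difference_family_def difference_family_def order_def
        pairwise_disjoint_mset_iff)
  have one: "size {#B \<in># F. y \<in> B#} = 1" if "y \<in> carrier G" for y
  proof -
    have "{#B \<in># F. y \<in> B#} \<noteq> {#}"
      using cov[OF that] by auto
    then show ?thesis
      using le[of y] by (metis le_neq_implies_less less_one size_eq_0_iff_empty)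
  qed
  \<comment> \<open>Double counting of incidences between elements and blocks gives p = |F|
    k.\<close>
  have "p = (\<Sum>y\<in>carrier G. size {#B \<in># F. y \<in> B#})"
    using one ord by simp
  also have "\<dots> = (\<Sum>B\<in>#F. \<Sum>y\<in>carrier G. of_bool (y \<in> B))"
    unfolding size_filter_eq_sum_mset by (rule sum_sum_mset_swap)
  also have "\<dots> = (\<Sum>B\<in>#F. k)"
  proof (intro arg_cong[where f = sum_mset] image_mset_cong)
    fix B
    assume "B \<in># F"
    then have "carrier G \<inter> B = B" "card B = k"
      using blk by auto
    then show "(\<Sum>y\<in>carrier G. of_bool (y \<in> B)) = k"
      using fin by (simp add: sum_of_bool_eq)
  qed
  finally have pk: "p = size F * k"
    by simp
  then have "k = 1 \<or> k = p"
    using p by (metis dvd_triv_right prime_nat_iff)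
  moreover have "k \<noteq> 1"
  proof
    assume "k = 1"
    have "card (carrier G) > 1"
      using ord prime_gt_1_nat[OF p] by simp
    then obtain x where x: "x \<in> carrier G" "x \<noteq> \<one>"
      by (metis card_le_Suc0_iff_eq fin not_le One_nat_def one_closed)
    have "diff_list G B = {#}" if B: "B \<in># F" for B
    proof -
      obtain b where "B = {b}"
        using blk[OF B] \<open>k = 1\<close> by (metis card_1_singletonE)
      then have "{(b, b'). b \<in> B \<and> b' \<in> B \<and> b \<noteq> b'} = {}" by auto
      then show ?thesis by (simp only: diff_list_def mset_set.empty image_mset_empty)
    qed
    then have "count (\<Sum>B\<in>#F. diff_list G B) x = 0"
      by (simp add: count_sum_mset_image)
    then show False
      using cnt[OF x] \<open>l > 0\<close> by simp
  qed
  ultimately have "k = p" by blast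
  then have "size F = 1"
    using pk prime_gt_0_nat[OF p] by simp
  then obtain B where F: "F = {#B#}"
    using size_1_singleton_mset by blast
  have "B = carrier G"
    using blk[of B] F fin ord \<open>k = p\<close> by (intro card_subset_eq) auto
  \<comment> \<open>The whole group as a block covers \<open>x\<close> exactly p times, so l = p =
    k, against the assumption l \<noteq> k.\<close>
  moreover have "disjoint_difference_family G p p p {#carrier G#}"
    using fin ord by (intro disjoint_difference_family_carrier) (auto simp: order_def is_group)
  moreover obtain x where "x \<in> carrier G" "x \<noteq> \<one>"
    using ord prime_gt_1_nat[OF p]
    by (metis card_le_Suc0_iff_eq fin not_le One_nat_def one_closed)
  ultimately have "l = p"
    using cnt[of x] F by (auto simp: disjoint_difference_family_def difference_family_def)
  then show False
    using \<open>l \<noteq> k\<close> \<open>k = p\<close> by simp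
qed

end

section \<open>Assembling the existence statements\<close>

lemma ex_index_family:
  assumes "ex_difference_family p k l" "prime p"
  shows "\<exists>F. index_family p k l F"
proof -
  obtain H :: "int monoid" and F where df: "difference_family H p k l F"
    using assms by (auto simp: ex_difference_family_def)
  interpret H: group H
    using df by (simp add: difference_family_def)
  show ?thesis
    using H.index_family_of_difference_family[OF df assms(2) H.one_closed] by blast
qed

text \<open>An uncovered element is placed at index 0, so no index set contains 0. Covering
  multiplicities do not grow when blocks are pulled back to indices.\<close>

lemma ex_disjoint_index_family:
  assumes "ex_disjoint_difference_family p k l" "prime p" "l > 0" "l \<noteq> k"
  shows "\<exists>F. disjoint_index_family p k l F"
proof -
  obtain H :: "int monoid" and F where ddf: "disjoint_difference_family H p k l F"
    using assms by (auto simp: ex_disjoint_difference_family_def)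
  then have df: "difference_family H p k l F"
    by (simp add: disjoint_difference_family_def)
  interpret H: group H
    using df by (simp add: difference_family_def)
  obtain y where y: "y \<in> carrier H" "\<And>B. B \<in># F \<Longrightarrow> y \<notin> B"
    using H.disjoint_difference_family_uncovered[OF ddf assms(2-4)] by blast
  obtain \<phi> :: "int \<Rightarrow> int" where \<phi>: "\<phi> 0 = y"
    "index_family p k l (image_mset (\<lambda>B. {i \<in> {0..<int p}. \<phi> i \<in> B}) F)"
    using H.index_family_of_difference_family[OF df assms(2) y(1)] by blast
  have "size {#I \<in># image_mset (\<lambda>B. {i \<in> {0..<int p}. \<phi> i \<in> B}) F. i \<in> I#} \<le> 1" for i
  proof -
    have "size {#I \<in># image_mset (\<lambda>B. {i \<in> {0..<int p}. \<phi> i \<in> B}) F. i \<in> I#}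
        = (\<Sum>B\<in>#F. of_bool (i \<in> {0..<int p} \<and> \<phi> i \<in> B))"
      by (simp add: size_filter_eq_sum_mset image_mset.compositionality comp_def)
    also have "\<dots> \<le> (\<Sum>B\<in>#F. of_bool (\<phi> i \<in> B))"
      by (intro sum_mset_mono) auto
    also have "\<dots> = size {#B \<in># F. \<phi> i \<in> B#}"
      by (simp add: size_filter_eq_sum_mset)
    also have "\<dots> \<le> 1"
      using ddf by (simp add: disjoint_difference_family_def pairwise_disjoint_mset_iff)
    finally show ?thesis .
  qed
  then show ?thesis
    using \<phi> y(2) unfolding disjoint_index_family_def
    by (intro exI[of _ "image_mset (\<lambda>B. {i \<in> {0..<int p}. \<phi> i \<in> B}) F"]) auto
qed

text \<open>A positive \<open>l\<close> forces some block to exist, and it fits into p residues.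
  This settles the case l = k of the theorem.\<close>

lemma ex_difference_family_block_le:
  assumes "ex_difference_family p k l" "prime p" "l > 0"
  shows "k \<le> p"
proof -
  obtain F where F: "index_family p k l F"
    using ex_index_family[OF assms(1,2)] by blast
  have "\<not> int p dvd 1"
    using prime_gt_1_nat[OF assms(2)] by simp
  then have "(\<Sum>I\<in>#F. card {(i, j) \<in> I \<times> I. int p dvd i - j - 1}) = l"
    using F unfolding index_family_def by blast
  then have "F \<noteq> {#}"
    using assms(3) by auto
  then obtain I where "I \<in># F" by auto
  then have "I \<subseteq> {0..<int p}" "card I = k"
    using F by (auto simp: index_family_def)
  then show ?thesis
    using card_mono[of "{0..<int p}" I] by simp
qed

theorem theorem2:
  fixes G :: "('a, 'm) monoid_scheme" (structure)
    and v k l :: nat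
  assumes "group G" and "finite (carrier G)" and "order G = v"
    and "k > 0" and "l > 0"
  shows "((\<forall>p. prime p \<and> p dvd v \<longrightarrow> ex_difference_family p k l) \<longrightarrow>
            (\<exists>F. difference_family G v k l F)) \<and>
         ((l = k \<longrightarrow> v \<le> k) \<longrightarrow>
            (\<forall>p. prime p \<and> p dvd v \<longrightarrow> ex_disjoint_difference_family p k l) \<longrightarrow>
            (\<exists>F. disjoint_difference_family G v k l F))"
proof (intro conjI impI)
  interpret group G by fact
  assume "\<forall>p. prime p \<and> p dvd v \<longrightarrow> ex_difference_family p k l"
  then have "\<forall>p. \<exists>F. prime p \<and> p dvd order G \<longrightarrow> index_family p k l F"
    using ex_index_family assms(3) by blast
  then obtain Fi where "\<And>p. prime p \<Longrightarrow> p dvd order G \<Longrightarrow> index_family p k l (Fi p)"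
    by metis
  then show "\<exists>F. difference_family G v k l F"
    using difference_family_lifted[OF assms(2)] assms(3) by blast
next
  interpret group G by fact
  assume lk: "l = k \<longrightarrow> v \<le> k"
    and ex: "\<forall>p. prime p \<and> p dvd v \<longrightarrow> ex_disjoint_difference_family p k l"
  show "\<exists>F. disjoint_difference_family G v k l F"
  proof (cases "l = k \<and> v \<noteq> 1")
    case True
    then obtain p where p: "prime p" "p dvd v"
      using prime_factor_nat by blast
    have "v > 0"
      using assms(2,3) by (metis order_gt_0_iff_finite)
    then have "p \<le> v"
      using p by (intro dvd_imp_le)
    have "ex_difference_family p k l"
      using ex p unfolding ex_difference_family_def ex_disjoint_difference_family_def
        disjoint_difference_family_def by blast
    then have "k \<le> p"
      using p assms(5) by (intro ex_difference_family_block_le)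
    \<comment> \<open>The chain k \<le> p \<le> v \<le> k collapses, so the whole group serves as
      the only block.\<close>
    then have "v = k" "l = k"
      using True lk \<open>p \<le> v\<close> by auto
    then show ?thesis
      using disjoint_difference_family_carrier[OF assms(1-3)] by auto
  next
    case False
    \<comment> \<open>A prime dividing \<open>v\<close> excludes v = 1, so here l \<noteq> k, as
      needed to find an uncovered element. For v = 1 the claim is vacuous.\<close>
    have "\<exists>F. prime p \<and> p dvd order G \<longrightarrow> disjoint_index_family p k l F" for p
    proof (cases "prime p \<and> p dvd v")
      case True
      then have "l \<noteq> k"
        using False by (metis nat_dvd_1_iff_1 not_prime_1)
      then show ?thesis
        using True ex ex_disjoint_index_family assms(5) by blast
    qed (use assms(3) in auto)
    then obtain Fi where "\<And>p. prime p \<Longrightarrow> p dvd order G \<Longrightarrow> disjoint_index_family p k l (Fi p)"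
      by metis
    then show ?thesis
      using disjoint_difference_family_lifted[OF assms(2)] assms(3) by blast
  qed
qed

end
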